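(* Let $p,q\ge 1$ and let $\mathbf{X}=(\mathbf{X}_1^\top,\mathbf{X}_2^\top)^\top\sim EC_{q+p}(\boldsymbol{\xi},\boldsymbol{\Omega},h^{(q+p)})$ with $\mathbf{X}_1\in\mathbb{R}^q$, $\mathbf{X}_2\in\mathbb{R}^p$. Let $C(\mathbf{c},\mathbf{d})=\{\mathbf{x}_1\in\mathbb{R}^q : \mathbf{c}\le \mathbf{x}_1\le \mathbf{d}\}$ and let $\mathbf{Y}\sim SLCT\text{-}EC_{p,q}(\boldsymbol{\xi},\boldsymbol{\Omega},h^{(q+p)},C(\mathbf{c},\mathbf{d}))$, i.e. $\mathbf{Y}\overset{d}{=}(\mathbf{X}_2\mid \mathbf{X}_1\in C(\mathbf{c},\mathbf{d}))$. Let $\mathbf{a},\mathbf{b}$ be $p$-dimensional lower and upper truncation limits (entries possibly infinite), and let $\mathbf{k}=(k_1,\dots,k_p)^\top$ with $k_i\in\mathbb{N}$ for $i=1,\dots,p$. Put $\boldsymbol{\kappa}=(\mathbf{0}_q^\top,\mathbf{k}^\top)^\top$, $\boldsymbol{\alpha}=(\mathbf{c}^\top,\mathbf{a}^\top)^\top$ and $\boldsymbol{\beta}=(\mathbf{d}^\top,\mathbf{b}^\top)^\top$. Then $$\mathbb{E}[\mathbf{Y}^{\mathbf{k}}\mid \mathbf{a}\le\mathbf{Y}\le\mathbf{b}]=\mathbb{E}[\mathbf{X}^{\boldsymbol{\kappa}}\mid \boldsymbol{\alpha}\le\mathbf{X}\le\boldsymbol{\beta}].$$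
   Context: Elliptical distribution: $\mathbf{X}\sim EC_{r}(\boldsymbol{\xi},\boldsymbol{\Omega},h^{(r)})$ means that $\mathbf{X}$ has density $|\boldsymbol{\Omega}|^{-1/2}h^{(r)}\big((\mathbf{x}-\boldsymbol{\xi})^\top\boldsymbol{\Omega}^{-1}(\mathbf{x}-\boldsymbol{\xi})\big)$ on $\mathbb{R}^r$, with location $\boldsymbol{\xi}\in\mathbb{R}^r$, positive-definite dispersion matrix $\boldsymbol{\Omega}$ and density generator $h^{(r)}$. For $r=q+p$, $\boldsymbol{\xi}$ and $\boldsymbol{\Omega}$ are partitioned conformably with $(\mathbf{X}_1,\mathbf{X}_2)$. Selection distribution: for measurable $C\subseteq\mathbb{R}^q$ with $\mathbb{P}(\mathbf{X}_1\in C)>0$, $SLCT\text{-}EC_{p,q}(\boldsymbol{\xi},\boldsymbol{\Omega},h^{(q+p)},C)$ is the conditional law of $\mathbf{X}_2$ given $\mathbf{X}_1\in C$. Vector inequalities are componentwise. For a vector $\mathbf{y}$ and a multi-index $\mathbf{k}$, the symbol $\mathbf{y}^{\mathbf{k}}$ inside an expectation denotes the product $y_1^{k_1}\cdots y_p^{k_p}$ (and similarly $\mathbf{x}^{\boldsymbol{\kappa}}$ for the $(q+p)$-vector $\mathbf{x}$); $\mathbb{N}$ includes $0$. Conditioning events are assumed to have positive probability, and the identity concerns moments that exist (either side exists if and only if the other does). *)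

theory Defs
  imports "HOL-Probability.Probability"
begin

text \<open>
  A vector of dimension $q + p$ is indexed by the sum type \<open>'q + 'p\<close>, so that a partition
  $(x_1, x_2)$ is the pair of restrictions to the \<open>Inl\<close> and the \<open>Inr\<close> indices.
\<close>

definition stack :: "'a ^ 'q \<Rightarrow> 'a ^ 'p \<Rightarrow> 'a ^ ('q::finite + 'p::finite)" where
  "stack u v = (\<chi> s. case s of Inl i \<Rightarrow> u $ i | Inr j \<Rightarrow> v $ j)"

definition block1 :: "'a ^ ('q::finite + 'p::finite) \<Rightarrow> 'a ^ 'q" where
  "block1 x = (\<chi> i. x $ Inl i)"

definition block2 :: "'a ^ ('q::finite + 'p::finite) \<Rightarrow> 'a ^ 'p" where
  "block2 x = (\<chi> j. x $ Inr j)"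

lemma stack_nth [simp]:
  "stack u v $ Inl i = u $ i" "stack u v $ Inr j = v $ j"
  by (simp_all add: stack_def)

lemma blocks_stack [simp]: "block1 (stack u v) = u" "block2 (stack u v) = v"
  by (simp_all add: block1_def block2_def vec_eq_iff)

lemma stack_blocks [simp]: "stack (block1 x) (block2 x) = x"
  by (simp add: stack_def block1_def block2_def vec_eq_iff split: sum.split)

definition positive_definite :: "real ^ 'n ^ 'n \<Rightarrow> bool" where
  "positive_definite A \<longleftrightarrow> transpose A = A \<and> (\<forall>x. x \<noteq> 0 \<longrightarrow> x \<bullet> (A *v x) > 0)"

definition ec_density :: "real ^ 'n \<Rightarrow> real ^ 'n ^ 'n \<Rightarrow> (real \<Rightarrow> real) \<Rightarrow> real ^ 'n \<Rightarrow> real" where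
  "ec_density \<xi> \<Omega> h x =
     det \<Omega> powr (- 1 / 2) * h ((x - \<xi>) \<bullet> (matrix_inv \<Omega> *v (x - \<xi>)))"

text \<open>
  Measurability and normalisation of the density (hence of the generator $h$) are part of
  \<open>distributed\<close> on a probability space. Nonnegativity of $h$ is stated separately,
  because \<open>ennreal\<close> truncates negative values to $0$.
\<close>

definition elliptical ::
  "'a measure \<Rightarrow> ('a \<Rightarrow> real ^ 'n) \<Rightarrow> real ^ 'n \<Rightarrow> real ^ 'n ^ 'n \<Rightarrow> (real \<Rightarrow> real) \<Rightarrow> bool" where
  "elliptical M X \<xi> \<Omega> h \<longleftrightarrow>
     positive_definite \<Omega> \<and> (\<forall>u\<ge>0. h u \<ge> 0) \<and>
     distributed M lborel X (\<lambda>x. ennreal (ec_density \<xi> \<Omega> h x))"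

definition ec_law :: "real ^ 'n \<Rightarrow> real ^ 'n ^ 'n \<Rightarrow> (real \<Rightarrow> real) \<Rightarrow> (real ^ 'n) measure" where
  "ec_law \<xi> \<Omega> h = density lborel (\<lambda>x. ennreal (ec_density \<xi> \<Omega> h x))"

text \<open>
  \<open>uniform_measure M A\<close> is the conditional measure $B \mapsto M(A \cap B) / M(A)$, for an
  arbitrary measure \<open>M\<close>.
\<close>

definition slct_ec_law ::
  "real ^ ('q::finite + 'p::finite) \<Rightarrow> real ^ ('q + 'p) ^ ('q + 'p) \<Rightarrow> (real \<Rightarrow> real) \<Rightarrow>
   (real ^ 'q) set \<Rightarrow> (real ^ 'p) measure" where
  "slct_ec_law \<xi> \<Omega> h C =
     distr (uniform_measure (ec_law \<xi> \<Omega> h) {x. block1 x \<in> C}) borel block2"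

definition slct_ec ::
  "'b measure \<Rightarrow> ('b \<Rightarrow> real ^ 'p) \<Rightarrow> real ^ ('q::finite + 'p::finite) \<Rightarrow>
   real ^ ('q + 'p) ^ ('q + 'p) \<Rightarrow> (real \<Rightarrow> real) \<Rightarrow> (real ^ 'q) set \<Rightarrow> bool" where
  "slct_ec N Y \<xi> \<Omega> h C \<longleftrightarrow>
     Y \<in> borel_measurable N \<and> distr N borel Y = slct_ec_law \<xi> \<Omega> h C"

definition extended_box :: "ereal ^ 'n \<Rightarrow> ereal ^ 'n \<Rightarrow> (real ^ 'n) set" where
  "extended_box l u = {x. \<forall>i. l $ i \<le> ereal (x $ i) \<and> ereal (x $ i) \<le> u $ i}"

definition vec_power :: "real ^ 'n \<Rightarrow> nat ^ 'n \<Rightarrow> real" where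
  "vec_power y k = (\<Prod>i\<in>UNIV. (y $ i) ^ (k $ i))"

definition event :: "'a measure \<Rightarrow> ('a \<Rightarrow> 'b) \<Rightarrow> 'b set \<Rightarrow> 'a set" where
  "event M X B = {\<omega> \<in> space M. X \<omega> \<in> B}"

text \<open>Expectation given an event; the moment exists iff \<open>cond_integrable\<close> holds.\<close>

definition cond_integrable :: "'a measure \<Rightarrow> ('a \<Rightarrow> real) \<Rightarrow> 'a set \<Rightarrow> bool" where
  "cond_integrable M f A \<longleftrightarrow> integrable (uniform_measure M A) f"

definition cond_expectation :: "'a measure \<Rightarrow> ('a \<Rightarrow> real) \<Rightarrow> 'a set \<Rightarrow> real" where
  "cond_expectation M f A = (\<integral>\<omega>. f \<omega> \<partial>uniform_measure M A)"

end

theory Submission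
  imports Defs
begin

text \<open>
  Conditioning commutes with taking image measures, and conditioning first on \<open>A\<close> and then on
  \<open>B\<close> is conditioning on \<open>A \<inter> B\<close>. Hence both sides of the identity are integrals of the same
  function against the image under the second block of the law of \<open>X\<close> conditioned on the stacked box.
\<close>

text \<open>Preimages commute with intersections, so numerator and denominator of the conditional
  measure are transported separately. No finiteness is involved, so the same rule serves
  \<open>M\<close>, \<open>N\<close> and the already conditioned law.\<close>

lemma uniform_measure_distr:
  assumes X: "X \<in> measurable M K" and B: "B \<in> sets K"
  shows "uniform_measure (distr M K X) B = distr (uniform_measure M (event M X B)) K X"
proof (rule measure_eqI)
  fix S assume "S \<in> sets (uniform_measure (distr M K X) B)"
  then have S: "S \<in> sets K" by simp
  have ev: "event M X B = X -` B \<inter> space M" by (auto simp: event_def)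
  have "X -` (B \<inter> S) \<inter> space M = (X -` B \<inter> space M) \<inter> (X -` S \<inter> space M)" by auto
  with X B S show "emeasure (uniform_measure (distr M K X) B) S =
      emeasure (distr (uniform_measure M (event M X B)) K X) S"
    by (simp add: ev emeasure_distr measurable_sets sets.Int)
qed simp

lemma ennreal_divide_divide_cancel:
  fixes x y m :: ennreal
  assumes "m \<noteq> 0" "m \<noteq> \<infinity>"
  shows "(x / m) / (y / m) = x / y"
proof -
  obtain r where r: "m = ennreal r" "0 < r"
    using assms by (cases m) (auto simp: less_le)
  then have inv: "inverse m * inverse (inverse m) = 1"
    by (simp add: inverse_ennreal flip: ennreal_mult)
  \<comment> \<open>On \<open>ennreal\<close>, inversion can fail to be multiplicative only for a
    product of 0 and \<infinity>. As \<open>inverse m\<close> is positive and finite,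
    \<open>y\<close> may be any value, including 0 and \<infinity>.\<close>
  have "inverse (y * inverse m) = inverse y * inverse (inverse m)"
    using r by (intro ennreal_inverse_mult') (auto simp: inverse_ennreal)
  then have "(x / m) / (y / m) = (x * inverse y) * (inverse m * inverse (inverse m))"
    by (simp only: divide_ennreal_def ac_simps)
  then show ?thesis
    by (simp only: inv mult_1_right divide_ennreal_def)
qed

text \<open>Both the numerator M(A \<inter> B \<inter> S) and the denominator M(A \<inter> B) get
  divided by M(A), and this common factor cancels. If A \<inter> B is null, the two sides still
  agree, being the same quotient by 0.\<close>

lemma uniform_measure_uniform_measure:
  assumes A: "A \<in> sets M" "emeasure M A \<noteq> 0" "emeasure M A \<noteq> \<infinity>" and B: "B \<in> sets M"
  shows "uniform_measure (uniform_measure M A) B = uniform_measure M (A \<inter> B)"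
proof (rule measure_eqI)
  fix S assume "S \<in> sets (uniform_measure (uniform_measure M A) B)"
  then have "S \<in> sets M" by simp
  with A B show "emeasure (uniform_measure (uniform_measure M A) B) S =
      emeasure (uniform_measure M (A \<inter> B)) S"
    by (simp add: sets.Int ennreal_divide_divide_cancel Int_assoc)
qed simp

lemma block1_borel_measurable [measurable]:
  "block1 \<in> borel_measurable (borel :: (real ^ ('q::finite + 'p::finite)) measure)"
  unfolding block1_def
  by (intro borel_measurable_continuous_onI continuous_intros)

lemma block2_borel_measurable [measurable]:
  "block2 \<in> borel_measurable (borel :: (real ^ ('q::finite + 'p::finite)) measure)"
  unfolding block2_def
  by (intro borel_measurable_continuous_onI continuous_intros)

lemma vec_power_borel_measurable [measurable]: "(\<lambda>y. vec_power y k) \<in> borel_measurable borel"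
  unfolding vec_power_def
  by (intro borel_measurable_continuous_onI continuous_intros)

lemma extended_box_borel [measurable]: "extended_box l u \<in> sets borel"
proof -
  have [measurable]: "(\<lambda>x. x $ i) \<in> borel_measurable borel" for i :: 'a
    by (intro borel_measurable_continuous_onI continuous_intros)
  show ?thesis unfolding extended_box_def by measurable
qed

lemma vec_power_stack_0: "vec_power x (stack 0 k) = vec_power (block2 x) k"
proof -
  have "vec_power x (stack 0 k) = (\<Prod>s\<in>UNIV <+> UNIV. (x $ s) ^ (stack 0 k $ s))"
    by (simp add: vec_power_def)
  \<comment> \<open>The product splits over the two summands of the index type. On the
    \<open>Inl\<close> side all exponents are 0, so every factor is 1, also at a zero coordinate
    because 0^0 = 1.\<close>
  also have "\<dots> = (\<Prod>i\<in>UNIV. (x $ Inr i) ^ (k $ i))"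
    by (subst prod.Plus) (simp_all)
  finally show ?thesis by (simp add: vec_power_def block2_def)
qed

text \<open>This puts the truncation event of X into the form produced by conditioning twice:
  selection on the first block, then truncation of the second.\<close>

lemma extended_box_stack:
  "extended_box (stack c a) (stack d b) = {x. block1 x \<in> extended_box c d} \<inter> {x. block2 x \<in> extended_box a b}"
proof -
  have "(\<forall>s. P s) \<longleftrightarrow> (\<forall>i. P (Inl i)) \<and> (\<forall>j. P (Inr j))" for P :: "'a + 'b \<Rightarrow> bool"
    by (metis sumE)
  from this[of "\<lambda>s. stack c a $ s \<le> ereal (x $ s) \<and> ereal (x $ s) \<le> stack d b $ s" for x]
  show ?thesis
    by (simp add: extended_box_def block1_def block2_def set_eq_iff)
qed

theorem theorem1:
  fixes M :: "'a measure" and N :: "'b measure"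
    and X :: "'a \<Rightarrow> real ^ ('q::finite + 'p::finite)" and Y :: "'b \<Rightarrow> real ^ 'p"
    and \<xi> :: "real ^ ('q + 'p)" and \<Omega> :: "real ^ ('q + 'p) ^ ('q + 'p)" and h :: "real \<Rightarrow> real"
    and c d :: "ereal ^ 'q" and a b :: "ereal ^ 'p" and k :: "nat ^ 'p"
  assumes "prob_space M" and "prob_space N"
    and "elliptical M X \<xi> \<Omega> h"
    and "measure M (event M (\<lambda>\<omega>. block1 (X \<omega>)) (extended_box c d)) > 0"
    and "slct_ec N Y \<xi> \<Omega> h (extended_box c d)"
    and "measure N (event N Y (extended_box a b)) > 0"
  defines "\<kappa> \<equiv> stack 0 k" and "\<alpha> \<equiv> stack c a" and "\<beta> \<equiv> stack d b"
  shows "(cond_integrable N (\<lambda>\<omega>. vec_power (Y \<omega>) k) (event N Y (extended_box a b)) \<longleftrightarrow>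
          cond_integrable M (\<lambda>\<omega>. vec_power (X \<omega>) \<kappa>) (event M X (extended_box \<alpha> \<beta>)))
       \<and> cond_expectation N (\<lambda>\<omega>. vec_power (Y \<omega>) k) (event N Y (extended_box a b)) =
         cond_expectation M (\<lambda>\<omega>. vec_power (X \<omega>) \<kappa>) (event M X (extended_box \<alpha> \<beta>))"
proof -
  interpret M: prob_space M by fact
  let ?L = "ec_law \<xi> \<Omega> h"
  let ?C = "{x. block1 x \<in> extended_box c d}" and ?D = "{x. block2 x \<in> extended_box a b}"
  let ?EY = "event N Y (extended_box a b)" and ?EX = "event M X (extended_box \<alpha> \<beta>)"
  from \<open>elliptical M X \<xi> \<Omega> h\<close> have "distributed M lborel X (\<lambda>x. ennreal (ec_density \<xi> \<Omega> h x))"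
    by (simp add: elliptical_def)
  then have X: "X \<in> borel_measurable M" and L: "?L = distr M borel X"
    by (auto simp: distributed_def ec_law_def cong: distr_cong)
  from \<open>slct_ec N Y \<xi> \<Omega> h (extended_box c d)\<close>
  have Y: "Y \<in> borel_measurable N"
    and law: "distr N borel Y = distr (uniform_measure ?L ?C) borel block2"
    by (auto simp: slct_ec_def slct_ec_law_def)
  have C: "?C \<in> sets borel" and D: "?D \<in> sets borel" by measurable
  have box: "extended_box \<alpha> \<beta> = ?C \<inter> ?D"
    by (simp add: \<alpha>_def \<beta>_def extended_box_stack)
  \<comment> \<open>The positivity hypothesis concerns an event of \<open>M\<close>; the
    cancellation needs it for the law \<open>?L\<close>.\<close>
  have "emeasure ?L ?C = emeasure M (event M (\<lambda>\<omega>. block1 (X \<omega>)) (extended_box c d))"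
    unfolding L using X C by (subst emeasure_distr) (auto simp: event_def intro!: arg_cong[where f="emeasure M"])
  then have pos: "emeasure ?L ?C \<noteq> 0" "emeasure ?L ?C \<noteq> \<infinity>"
    using assms(4) by (auto simp: M.emeasure_eq_measure)
  have setsL: "sets ?L = sets borel" by (simp add: L)
  have block2: "block2 \<in> borel_measurable (uniform_measure ?L ?C)"
    by (subst measurable_cong_sets[of _ borel _ borel]) (simp_all add: setsL)
  have "distr (uniform_measure N ?EY) borel Y = uniform_measure (distr N borel Y) (extended_box a b)"
    using Y by (simp add: uniform_measure_distr)
  \<comment> \<open>Truncating Y becomes a second conditioning, on \<open>?D\<close>, carried out
    before projecting to the second block.\<close>
  also have "\<dots> = distr (uniform_measure (uniform_measure ?L ?C)
      (event (uniform_measure ?L ?C) block2 (extended_box a b))) borel block2"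
    unfolding law using block2 by (simp add: uniform_measure_distr)
  also have "event (uniform_measure ?L ?C) block2 (extended_box a b) = ?D"
    by (auto simp: event_def L)
  also have "uniform_measure (uniform_measure ?L ?C) ?D = uniform_measure ?L (extended_box \<alpha> \<beta>)"
    using C D pos by (simp add: uniform_measure_uniform_measure setsL box)
  also have "\<dots> = distr (uniform_measure M ?EX) borel X"
    unfolding L using X by (simp add: uniform_measure_distr)
  also have "distr \<dots> borel block2 = distr (uniform_measure M ?EX) borel (\<lambda>\<omega>. block2 (X \<omega>))"
    using X by (simp add: distr_distr comp_def)
  finally have eq: "distr (uniform_measure N ?EY) borel Y =
    distr (uniform_measure M ?EX) borel (\<lambda>\<omega>. block2 (X \<omega>))" .
  have X2: "(\<lambda>\<omega>. block2 (X \<omega>)) \<in> borel_measurable (uniform_measure M ?EX)"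
    using X by simp
  have Y': "Y \<in> borel_measurable (uniform_measure N ?EY)"
    using Y by simp
  show ?thesis
    \<comment> \<open>Existence and value of the moment depend only on the law in \<open>eq\<close>.
      If the moment does not exist, both integrals take the default value 0, so the equality of
      values needs no case distinction.\<close>
    using arg_cong[OF eq, of "\<lambda>\<mu>. integrable \<mu> (\<lambda>y. vec_power y k)"]
      arg_cong[OF eq, of "\<lambda>\<mu>. \<integral>y. vec_power y k \<partial>\<mu>"]
    by (simp add: \<kappa>_def vec_power_stack_0 cond_integrable_def cond_expectation_def
        integrable_distr_eq[OF X2] integrable_distr_eq[OF Y'] integral_distr[OF X2] integral_distr[OF Y'])
qed

end
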